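(* Let $\Gamma$ be a countable group, and fix a generic sequence $\langle(\gamma_n,s_n):n\in\omega\rangle$ with its associated graph $G_\Gamma$ and action $a_\Gamma$ on $\Gamma\times 2^\omega$. For any Borel graph $G$ on $\mathcal{N}$ and any Borel action $a$ of $\Gamma$ on $\mathcal{N}$, either $(G,a)$ admits a Borel $a$-coloring or there is an equivariant homomorphism from $G_\Gamma$ to $G$, i.e. a map $f:\Gamma\times 2^\omega\to\mathcal{N}$ such that (1) $f(h\cdot_{a_\Gamma}x)=h\cdot_a f(x)$ for all $h\in\Gamma$ and $x\in\Gamma\times 2^\omega$, and (2) if $x\mathrel{G_\Gamma}y$ then $f(x)\mathrel{G}f(y)$.
   Context: $\mathcal{N}=\omega^\omega$. A graph on $X$ is a symmetric irreflexive subset of $X^2$. For a Borel graph $G$ on a space $X$, a countable group $\Gamma$, and an action $a$ of $\Gamma$ on $X$, a function $f:X\to\omega\times\Gamma$ is an $a$-coloring of $(G,a)$ if for every $n\in\omega$ the set $\{h\cdot_a x: x\in X,\ h\in\Gamma,\ f(x)=(n,h)\}$ is $G$-independent (contains no two $G$-adjacent points). A sequence $\langle(\gamma_n,s_n):n\in\omega\rangle$ with $(\gamma_n,s_n)\in\Gamma\times 2^n$ is generic if for each $\gamma\in\Gamma$ we have $\gamma=\gamma_n$ for infinitely many $n$, and every string in $2^{<\omega}$ is extended by some $s_n$. $G_\Gamma$ is the graph on $\Gamma\times 2^\omega$ in which $x,y$ are adjacent iff, for some $n\in\omega$ and $z\in 2^\omega$, $\{x,y\}=\{(\gamma_n,s_n\,0\,z),(\gamma_n,s_n\,1\,z)\}$,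 where juxtaposition of sequences denotes concatenation. The action $a_\Gamma$ of $\Gamma$ on $\Gamma\times 2^\omega$ is $\gamma\cdot(\gamma',z)=(\gamma\gamma',z)$. *)

theory Defs
  imports
    "HOL-Analysis.Analysis"
    "HOL-Algebra.Group_Action"
    "HOL-Library.Omega_Words_Fun"
    "HOL-Library.Sublist"
begin

(* Conventions: \<N> is the type nat \<Rightarrow> nat with the library's product topology;
   2^\<omega> is nat \<Rightarrow> bool and 2^{<\<omega>} is bool list, with False for 0 and True for 1;
   an action of \<Gamma> on a whole type is group_action \<Gamma> UNIV a, with a h x for h \<cdot> x.
   A countable group carries the discrete topology, hence count_space below. *)

definition graph_rel :: "('x \<times> 'x) set \<Rightarrow> bool" where
  "graph_rel G \<longleftrightarrow> sym G \<and> irrefl G"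

definition borel_graph :: "('x::topological_space \<times> 'x) set \<Rightarrow> bool" where
  "borel_graph G \<longleftrightarrow> graph_rel G \<and> G \<in> sets borel"

definition independent_set :: "('x \<times> 'x) set \<Rightarrow> 'x set \<Rightarrow> bool" where
  "independent_set G A \<longleftrightarrow> (\<forall>x\<in>A. \<forall>y\<in>A. (x, y) \<notin> G)"

definition borel_action ::
    "('g, 'm) monoid_scheme \<Rightarrow> ('g \<Rightarrow> 'x::topological_space \<Rightarrow> 'x) \<Rightarrow> bool" where
  "borel_action \<Gamma> a \<longleftrightarrow>
     group_action \<Gamma> UNIV a \<and>
     (\<lambda>(h, x). a h x) \<in> measurable (count_space (carrier \<Gamma>) \<Otimes>\<^sub>M borel) borel"

definition a_coloring ::
    "('g, 'm) monoid_scheme \<Rightarrow> ('x \<times> 'x) set \<Rightarrow> ('g \<Rightarrow> 'x \<Rightarrow> 'x) \<Rightarrow> ('x \<Rightarrow> nat \<times> 'g) \<Rightarrow> bool" where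
  "a_coloring \<Gamma> G a f \<longleftrightarrow>
     f \<in> UNIV \<rightarrow> UNIV \<times> carrier \<Gamma> \<and>
     (\<forall>n. independent_set G {a h x | x h. h \<in> carrier \<Gamma> \<and> f x = (n, h)})"

definition borel_a_coloring ::
    "('g, 'm) monoid_scheme \<Rightarrow> ('x::topological_space \<times> 'x) set \<Rightarrow> ('g \<Rightarrow> 'x \<Rightarrow> 'x)
       \<Rightarrow> ('x \<Rightarrow> nat \<times> 'g) \<Rightarrow> bool" where
  "borel_a_coloring \<Gamma> G a f \<longleftrightarrow>
     a_coloring \<Gamma> G a f \<and> f \<in> measurable borel (count_space (UNIV \<times> carrier \<Gamma>))"

definition generic_seq ::
    "('g, 'm) monoid_scheme \<Rightarrow> (nat \<Rightarrow> 'g) \<Rightarrow> (nat \<Rightarrow> bool list) \<Rightarrow> bool" where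
  "generic_seq \<Gamma> \<gamma> s \<longleftrightarrow>
     (\<forall>n. \<gamma> n \<in> carrier \<Gamma> \<and> length (s n) = n) \<and>
     (\<forall>g\<in>carrier \<Gamma>. infinite {n. \<gamma> n = g}) \<and>
     (\<forall>t. \<exists>n. Sublist.prefix t (s n))"

definition G_Gamma ::
    "(nat \<Rightarrow> 'g) \<Rightarrow> (nat \<Rightarrow> bool list) \<Rightarrow> (('g \<times> (nat \<Rightarrow> bool)) \<times> ('g \<times> (nat \<Rightarrow> bool))) set" where
  "G_Gamma \<gamma> s =
     {(x, y). \<exists>n z. {x, y} = {(\<gamma> n, s n \<frown> [False] \<frown> z), (\<gamma> n, s n \<frown> [True] \<frown> z)}}"

definition a_Gamma ::
    "('g, 'm) monoid_scheme \<Rightarrow> 'g \<Rightarrow> 'g \<times> (nat \<Rightarrow> bool) \<Rightarrow> 'g \<times> (nat \<Rightarrow> bool)" where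
  "a_Gamma \<Gamma> h x = (h \<otimes>\<^bsub>\<Gamma>\<^esub> fst x, snd x)"

(* f matters only on \<Gamma> \<times> 2^\<omega>, i.e. on carrier \<Gamma> \<times> UNIV; for a generic sequence
   G_Gamma is contained in the square of this set. *)
definition equivariant_hom ::
    "('g, 'm) monoid_scheme \<Rightarrow> (nat \<Rightarrow> 'g) \<Rightarrow> (nat \<Rightarrow> bool list)
       \<Rightarrow> ('x \<times> 'x) set \<Rightarrow> ('g \<Rightarrow> 'x \<Rightarrow> 'x) \<Rightarrow> ('g \<times> (nat \<Rightarrow> bool) \<Rightarrow> 'x) \<Rightarrow> bool" where
  "equivariant_hom \<Gamma> \<gamma> s G a f \<longleftrightarrow>
     (\<forall>h\<in>carrier \<Gamma>. \<forall>x\<in>carrier \<Gamma> \<times> UNIV. f (a_Gamma \<Gamma> h x) = a h (f x)) \<and>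
     (\<forall>x y. (x, y) \<in> G_Gamma \<gamma> s \<longrightarrow> (f x, f y) \<in> G)"

end

theory Submission
  imports Defs
begin

text \<open>
  Put \<open>R k = {(x, y). (\<gamma> k x, \<gamma> k y) \<in> G}\<close>. An equivariant homomorphism amounts to a map F on \<open>2\<^sup>\<omega>\<close> sending
  the pair \<open>s k 0 z\<close>, \<open>s k 1 z\<close> into \<open>R k\<close> for all k and z, and a cover of the space by countably many Borel
  sets, each independent for some \<open>R k\<close>, yields a Borel coloring. So suppose there is no such cover. Call
  a set of finite approximations to F large if no countable family of Borel independent sets meets all
  of them. Large sets behave like the positive sets of a \<sigma>-ideal, so they can be shrunk to small diameter.
  The heart of the proof is that approximations from a large closed set can be amalgamated along an
  edge of \<open>R n\<close> with the result still large: otherwise the relevant points would form an analytic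
  \<open>R n\<close>-independent set, which by Lusin separation lies in a Borel \<open>R n\<close>-independent set, contradicting
  largeness. Iterating gives F as a limit. This replaces the transfinite derivative in the usual proof
  of the \<open>G\<^sub>0\<close> dichotomy.
\<close>

text \<open>
  The library equips nat only with a topology; a metric is needed to make \<open>\<N>\<close> an instance of
  \<open>polish_space\<close>.
\<close>

instantiation nat :: metric_space
begin

definition dist_nat :: "nat \<Rightarrow> nat \<Rightarrow> real" where
  "dist_nat m n = \<bar>real m - real n\<bar>"

definition uniformity_nat :: "(nat \<times> nat) filter" where
  "uniformity_nat = (INF e\<in>{0<..}. principal {(x, y). dist x y < e})"

instance
proof
  show "open U \<longleftrightarrow> (\<forall>x\<in>U. \<forall>\<^sub>F (x', y) in uniformity. x' = x \<longrightarrow> y \<in> U)" for U :: "nat set"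
  proof -
    have "\<forall>\<^sub>F (x', y) in uniformity. x' = (x::nat) \<longrightarrow> y = x" for x
      unfolding uniformity_nat_def
      by (rule eventually_INF1[of 1]) (auto simp: eventually_principal dist_nat_def)
    then have "\<forall>\<^sub>F (x', y) in uniformity. x' = x \<longrightarrow> y \<in> U" if "x \<in> U" for x
      by (rule eventually_mono) (use that in auto)
    then show ?thesis
      by (simp add: open_discrete)
  qed
qed (auto simp: dist_nat_def uniformity_nat_def)

end

instance nat :: complete_space
proof
  fix X :: "nat \<Rightarrow> nat" assume "Cauchy X"
  then obtain M where "\<forall>m\<ge>M. \<forall>n\<ge>M. dist (X m) (X n) < 1"
    by (meson metric_CauchyD zero_less_one)
  then have "X n = X M" if "n \<ge> M" for n
    using that by (fastforce simp: dist_nat_def)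
  then show "convergent X"
    unfolding convergent_def by (metis (mono_tags, lifting) eventually_at_top_linorder tendsto_eventually)
qed

instance nat :: polish_space ..

instance prod :: (polish_space, polish_space) polish_space ..

section \<open>Metric tools: small closed covers and geometric convergence\<close>

lemma closed_small_cover:
  fixes e :: real
  assumes "e > 0"
  obtains K :: "nat \<Rightarrow> 'a::{metric_space, second_countable_topology} set"
  where "\<And>i. closed (K i)" "\<And>i x y. x \<in> K i \<Longrightarrow> y \<in> K i \<Longrightarrow> dist x y < e" "(\<Union>i. K i) = UNIV"
proof -
  obtain D :: "'a set" where D: "countable D" "\<And>X. open X \<Longrightarrow> X \<noteq> {} \<Longrightarrow> \<exists>d\<in>D. d \<in> X"
    using countable_dense_setE by blast
  have near: "\<exists>d\<in>D. x \<in> cball d (e/3)" for x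
    using D(2)[of "ball x (e/3)"] assms by (auto simp: dist_commute intro: less_imp_le)
  then have "D \<noteq> {}"
    by blast
  show thesis
  proof
    show "dist x y < e"
      if "x \<in> cball (from_nat_into D i) (e/3)" "y \<in> cball (from_nat_into D i) (e/3)" for i x y
      using that assms dist_triangle3[of x y "from_nat_into D i"] by simp
    show "(\<Union>i. cball (from_nat_into D i) (e/3)) = UNIV"
    proof (rule UNIV_eq_I[symmetric])
      fix x
      obtain d where d: "d \<in> D" "x \<in> cball d (e/3)"
        using near by blast
      then obtain i where "from_nat_into D i = d"
        using from_nat_into_surj[OF D(1)] by blast
      with d(2) show "x \<in> (\<Union>i. cball (from_nat_into D i) (e/3))"
        by blast
    qed
  qed auto
qed

lemma geometric_steps_LIMSEQ:
  fixes y :: "nat \<Rightarrow> 'a::complete_space"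
  assumes step: "\<And>n. dist (y n) (y (Suc n)) \<le> (1/2) ^ n"
  obtains L where "y \<longlonglongrightarrow> L"
proof -
  \<comment> \<open>The radii are chosen so that the balls nest: a step of \<open>(1/2)^n\<close>
    plus the next radius \<open>2 * (1/2)^(n+1)\<close> is exactly
    \<open>2 * (1/2)^n\<close>.\<close>
  let ?S = "\<lambda>n. cball (y n) (2 * (1/2) ^ n)"
  have "?S (Suc n) \<subseteq> ?S n" for n
  proof
    fix x assume "x \<in> ?S (Suc n)"
    then show "x \<in> ?S n"
      using step[of n] dist_triangle[of "y n" x "y (Suc n)"] by simp
  qed
  then have nest: "m \<le> n \<Longrightarrow> ?S n \<subseteq> ?S m" for m n
    by (rule lift_Suc_antimono_le)
  have lim0: "(\<lambda>n. 2 * (1/2::real) ^ n) \<longlonglongrightarrow> 0"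
    by (intro tendsto_mult_right_zero LIMSEQ_power_zero) simp
  have small: "\<exists>n. \<forall>x\<in>?S n. \<forall>x'\<in>?S n. dist x x' < e" if "e > 0" for e
  proof -
    have "\<forall>\<^sub>F n in sequentially. 2 * (1/2::real) ^ n < e/2"
      by (rule order_tendstoD(2)[OF lim0]) (use that in simp)
    then obtain n where n: "2 * (1/2::real) ^ n < e/2"
      by (auto simp: eventually_sequentially)
    have "dist x x' < e" if "x \<in> ?S n" "x' \<in> ?S n" for x x'
      using that n dist_triangle3[of x x' "y n"] unfolding mem_cball by linarith
    then show ?thesis
      by blast
  qed
  obtain L where L: "\<And>n. L \<in> ?S n"
    by (rule decreasing_closed_nest[of ?S]) (use nest small in auto)
  have "y \<longlonglongrightarrow> L"
    by (rule metric_tendsto_imp_tendsto[OF lim0]) (use L in \<open>auto simp: dist_commute\<close>)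
  then show thesis ..
qed

subsection \<open>Lusin separation\<close>

text \<open>These are the analytic sets, encoded as projections of closed sets along Baire space.
  The second coordinate serves as a witness of membership, and the configurations below store such
  witnesses.\<close>

definition suslin :: "'a::topological_space set \<Rightarrow> bool" where
  "suslin S \<longleftrightarrow> (\<exists>C :: ('a \<times> (nat \<Rightarrow> nat)) set. closed C \<and> S = fst ` C)"

lemma suslin_closed: "closed S \<Longrightarrow> suslin S"
  unfolding suslin_def by (rule exI[of _ "S \<times> UNIV"]) (auto intro: closed_Times)

lemma suslin_UN:
  assumes "\<And>n::nat. suslin (S n)"
  shows "suslin (\<Union>n. S n)"
proof -
  obtain C where C: "\<And>n. closed (C n)" "\<And>n. S n = fst ` (C n :: ('a \<times> (nat \<Rightarrow> nat)) set)"
    using assms unfolding suslin_def by metis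
  define h :: "'a \<times> (nat \<Rightarrow> nat) \<Rightarrow> _" where "h p = (fst p, \<lambda>m. snd p (Suc m))" for p
  \<comment> \<open>The entry \<open>w 0\<close> selects an index and the shifted tail of
    \<open>w\<close> is the witness for it. The intersection form imposes a condition only at
    \<open>n = w 0\<close> and makes closedness visible.\<close>
  define D where "D = (\<Inter>n. {p. snd p 0 \<noteq> n} \<union> h -` C n)"
  have coord: "continuous_on UNIV (\<lambda>p :: 'a \<times> (nat \<Rightarrow> nat). snd p k)" for k
    by (rule continuous_on_product_then_coordinatewise[OF continuous_on_snd[OF continuous_on_id]])
  have "continuous_on UNIV h"
    unfolding h_def
    by (intro continuous_on_Pair continuous_on_coordinatewise_then_product coord continuous_on_fst continuous_on_id)
  then have "closed (h -` C n)" for n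
    using C(1) by (rule closed_vimage[rotated])
  moreover have "closed {p :: 'a \<times> (nat \<Rightarrow> nat). snd p 0 \<noteq> n}" for n
    using closed_vimage[OF _ coord[of 0], of "- {n}"]
    by (simp add: vimage_def Compl_eq closed_def open_discrete)
  ultimately have "closed D"
    unfolding D_def by (intro closed_INT ballI closed_Un) auto
  moreover have "(\<Union>n. S n) = fst ` D"
  proof (intro equalityI subsetI)
    fix x assume "x \<in> (\<Union>n. S n)"
    then obtain n w where "(x, w) \<in> C n"
      by (auto simp: C(2))
    then have "(x, case_nat n w) \<in> D"
      by (auto simp: D_def h_def)
    then show "x \<in> fst ` D"
      by force
  next
    fix x assume "x \<in> fst ` D"
    then obtain w where "(x, w) \<in> D"
      by auto
    then have "h (x, w) \<in> C (w 0)"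
      by (auto simp: D_def)
    then have "fst (h (x, w)) \<in> fst ` C (w 0)"
      by (rule imageI)
    then show "x \<in> (\<Union>n. S n)"
      by (auto simp: C(2) h_def)
  qed
  ultimately show ?thesis
    unfolding suslin_def by blast
qed

text \<open>A single sequence codes a witness for every \<open>S n\<close> at once, the n-th one
  being read off along \<open>prod_encode (n, _)\<close>.\<close>

lemma suslin_INT:
  assumes "\<And>n::nat. suslin (S n)"
  shows "suslin (\<Inter>n. S n)"
proof -
  obtain C where C: "\<And>n. closed (C n)" "\<And>n. S n = fst ` (C n :: ('a \<times> (nat \<Rightarrow> nat)) set)"
    using assms unfolding suslin_def by metis
  define h :: "nat \<Rightarrow> 'a \<times> (nat \<Rightarrow> nat) \<Rightarrow> _"
    where "h n p = (fst p, \<lambda>m. snd p (prod_encode (n, m)))" for n p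
  define D where "D = (\<Inter>n. h n -` C n)"
  have "continuous_on UNIV (h n)" for n
    unfolding h_def
    by (intro continuous_on_Pair continuous_on_coordinatewise_then_product continuous_on_fst continuous_on_id
        continuous_on_product_then_coordinatewise[OF continuous_on_snd[OF continuous_on_id]])
  then have "closed D"
    unfolding D_def using C(1) by (intro closed_INT ballI closed_vimage) auto
  moreover have "(\<Inter>n. S n) = fst ` D"
  proof (intro equalityI subsetI)
    fix x assume "x \<in> (\<Inter>n. S n)"
    then have "\<forall>n. \<exists>w. (x, w) \<in> C n"
      by (force simp: C(2))
    then obtain w where "\<And>n. (x, w n) \<in> C n"
      by metis
    then have "(x, \<lambda>i. w (fst (prod_decode i)) (snd (prod_decode i))) \<in> D"
      by (auto simp: D_def h_def)
    then show "x \<in> fst ` D"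
      by force
  next
    fix x assume "x \<in> fst ` D"
    then obtain w where "(x, w) \<in> D"
      by auto
    then have "h n (x, w) \<in> C n" for n
      by (auto simp: D_def)
    then have "fst (h n (x, w)) \<in> fst ` C n" for n
      by (rule imageI)
    then show "x \<in> (\<Inter>n. S n)"
      by (auto simp: C(2) h_def)
  qed
  ultimately show ?thesis
    unfolding suslin_def by blast
qed

lemma suslin_open:
  fixes S :: "'a::metric_space set"
  assumes "open S"
  shows "suslin S"
proof -
  have "fsigma_in euclidean S"
    using assms by (simp add: open_imp_fsigma_in metrizable_space_euclidean)
  then obtain C :: "nat \<Rightarrow> 'a set" where "\<And>n. closed (C n)" "\<Union>(range C) = S"
    unfolding fsigma_in_ascending by auto
  then show ?thesis
    using suslin_UN[of C] suslin_closed by auto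
qed

lemma suslin_borel:
  fixes S :: "'a::metric_space set"
  assumes "S \<in> sets borel"
  shows "suslin S"
proof -
  have "S \<in> sigma_sets UNIV {S. open S}"
    using assms by (simp add: sets_borel)
  \<comment> \<open>Analytic sets are not closed under complement, so the induction carries
    \<open>S\<close> and \<open>- S\<close> together.\<close>
  then have "suslin S \<and> suslin (- S)"
  proof induction
    case (Basic S)
    then show ?case
      by (auto intro: suslin_open suslin_closed)
  next
    case Empty
    then show ?case
      by (auto intro: suslin_closed)
  next
    case (Compl S)
    then show ?case
      by (simp add: Compl_eq_Diff_UNIV[symmetric])
  next
    case (Union S)
    then show ?case
      using suslin_UN[of S] suslin_INT[of "\<lambda>n. - S n"] by (simp add: Compl_UN)
  qed
  then show ?thesis ..
qed

section \<open>Separation of disjoint analytic sets\<close>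

definition borel_separated :: "'a::topological_space set \<Rightarrow> 'a set \<Rightarrow> bool" where
  "borel_separated A B \<longleftrightarrow> (\<exists>D\<in>sets borel. A \<subseteq> D \<and> B \<inter> D = {})"

text \<open>Used contrapositively: if two countable unions cannot be separated, some pair of their
  pieces cannot be either.\<close>

lemma borel_separated_UN:
  assumes "\<And>(i::nat) (j::nat). borel_separated (A i) (B j)"
  shows "borel_separated (\<Union>i. A i) (\<Union>j. B j)"
proof -
  obtain D where D: "\<And>i j. D i j \<in> sets borel" "\<And>i j. A i \<subseteq> D i j" "\<And>i j. B j \<inter> D i j = {}"
    using assms unfolding borel_separated_def by metis
  show ?thesis
    unfolding borel_separated_def
  proof (intro bexI conjI)
    show "(\<Union>i. \<Inter>j. D i j) \<in> sets borel"
      by (intro sets.countable_UN'' sets.countable_INT'' D(1)) auto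
    show "(\<Union>i. A i) \<subseteq> (\<Union>i. \<Inter>j. D i j)"
      using D(2) by (intro UN_mono INT_greatest) auto
    have False if "x \<in> B j" "x \<in> (\<Inter>j. D i j)" for x i j
      using D(3)[of j i] that by auto
    then show "(\<Union>j. B j) \<inter> (\<Union>i. \<Inter>j. D i j) = {}"
      by auto
  qed
qed

text \<open>An inseparable pair is cut down repeatedly to inseparable closed pairs of vanishing
  diameter. These shrink to points \<open>x\<close> and \<open>y\<close> with
  \<open>f x \<noteq> g y\<close>; by continuity, disjoint open neighbourhoods of the two values
  already separate the images at a late stage.\<close>

lemma borel_separated_closed_images:
  fixes f :: "'a::polish_space \<Rightarrow> 'c::t2_space" and g :: "'b::polish_space \<Rightarrow> 'c"
  assumes f: "continuous_on UNIV f" and g: "continuous_on UNIV g"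
    and "closed S" "closed T" and disj: "f ` S \<inter> g ` T = {}"
  shows "borel_separated (f ` S) (g ` T)"
proof (rule ccontr)
  define bad where
    "bad C D \<longleftrightarrow> closed C \<and> closed D \<and> C \<subseteq> S \<and> D \<subseteq> T \<and> \<not> borel_separated (f ` C) (g ` D)" for C D
  define small where
    "small n C D \<longleftrightarrow> (\<forall>x\<in>C. \<forall>y\<in>C. dist x y < 1 / Suc n) \<and> (\<forall>x\<in>D. \<forall>y\<in>D. dist x y < 1 / Suc n)"
    for n and C :: "'a set" and D :: "'b set"
  have step: "\<exists>C' D'. bad C' D' \<and> small n C' D' \<and> C' \<subseteq> C \<and> D' \<subseteq> D" if CD: "bad C D" for C D n
  proof -
    have pos: "1 / real (Suc n) > 0"
      by simp
    obtain K :: "nat \<Rightarrow> 'a set"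
      where K: "\<And>i. closed (K i)" "\<And>i x y. x \<in> K i \<Longrightarrow> y \<in> K i \<Longrightarrow> dist x y < 1 / Suc n" "(\<Union>i. K i) = UNIV"
      using closed_small_cover[OF pos] by blast
    obtain L :: "nat \<Rightarrow> 'b set"
      where L: "\<And>i. closed (L i)" "\<And>i x y. x \<in> L i \<Longrightarrow> y \<in> L i \<Longrightarrow> dist x y < 1 / Suc n" "(\<Union>i. L i) = UNIV"
      using closed_small_cover[OF pos] by blast
    have "f ` C = (\<Union>i. f ` (C \<inter> K i))" "g ` D = (\<Union>j. g ` (D \<inter> L j))"
      using K(3) L(3) by blast+
    then obtain i j where "\<not> borel_separated (f ` (C \<inter> K i)) (g ` (D \<inter> L j))"
      using CD borel_separated_UN[of "\<lambda>i. f ` (C \<inter> K i)" "\<lambda>j. g ` (D \<inter> L j)"] by (auto simp: bad_def)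
    then have "bad (C \<inter> K i) (D \<inter> L j)" "small n (C \<inter> K i) (D \<inter> L j)"
      using CD K(1,2) L(1,2) by (auto simp: bad_def small_def)
    then show ?thesis
      by blast
  qed
  assume "\<not> borel_separated (f ` S) (g ` T)"
  then have "bad S T"
    using assms by (simp add: bad_def)
  have "\<exists>X. \<forall>n. (bad (fst (X n)) (snd (X n)) \<and> small n (fst (X n)) (snd (X n)))
      \<and> (fst (X (Suc n)) \<subseteq> fst (X n) \<and> snd (X (Suc n)) \<subseteq> snd (X n))"
  proof (rule dependent_nat_choice)
    show "\<exists>X. bad (fst X) (snd X) \<and> small 0 (fst X) (snd X)"
      using step[OF \<open>bad S T\<close>, of 0] by auto
    show "\<exists>Y. (bad (fst Y) (snd Y) \<and> small (Suc n) (fst Y) (snd Y)) \<and> (fst Y \<subseteq> fst X \<and> snd Y \<subseteq> snd X)"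
      if "bad (fst X) (snd X) \<and> small n (fst X) (snd X)" for X n
      using step[of "fst X" "snd X" "Suc n"] that by auto
  qed
  then obtain X where X: "\<And>n. bad (fst (X n)) (snd (X n))" "\<And>n. small n (fst (X n)) (snd (X n))"
    "\<And>n. fst (X (Suc n)) \<subseteq> fst (X n)" "\<And>n. snd (X (Suc n)) \<subseteq> snd (X n)"
    by blast
  \<comment> \<open>An empty image would be separated from anything, by \<open>{}\<close> or by
    \<open>UNIV\<close>.\<close>
  have nonempty: "fst (X n) \<noteq> {}" "snd (X n) \<noteq> {}" for n
    using X(1)[of n] by (auto simp: bad_def borel_separated_def)
  have nest: "m \<le> n \<Longrightarrow> fst (X n) \<subseteq> fst (X m)" "m \<le> n \<Longrightarrow> snd (X n) \<subseteq> snd (X m)" for m n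
    using lift_Suc_antimono_le[of "\<lambda>n. fst (X n)", OF X(3)] lift_Suc_antimono_le[of "\<lambda>n. snd (X n)", OF X(4)]
    by auto
  have eps: "\<exists>N. \<forall>n\<ge>N. 1 / real (Suc n) < e" if "e > 0" for e :: real
    using order_tendstoD(2)[OF LIMSEQ_Suc[OF lim_1_over_n] that]
    by (simp add: eventually_sequentially)
  obtain x where x: "\<And>n. x \<in> fst (X n)"
  proof (rule decreasing_closed_nest[of "\<lambda>n. fst (X n)"])
    show "\<exists>n. \<forall>x\<in>fst (X n). \<forall>y\<in>fst (X n). dist x y < e" if "e > 0" for e
      using eps[OF that] X(2) unfolding small_def by (meson less_trans order_refl)
  qed (use nonempty nest X(1) in \<open>auto simp: bad_def\<close>)
  obtain y where y: "\<And>n. y \<in> snd (X n)"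
  proof (rule decreasing_closed_nest[of "\<lambda>n. snd (X n)"])
    show "\<exists>n. \<forall>x\<in>snd (X n). \<forall>y\<in>snd (X n). dist x y < e" if "e > 0" for e
      using eps[OF that] X(2) unfolding small_def by (meson less_trans order_refl)
  qed (use nonempty nest X(1) in \<open>auto simp: bad_def\<close>)
  have "x \<in> S" "y \<in> T"
    using x[of 0] y[of 0] X(1)[of 0] by (auto simp: bad_def)
  then have "f x \<noteq> g y"
    using disj by blast
  then obtain U V where UV: "open U" "open V" "f x \<in> U" "g y \<in> V" "U \<inter> V = {}"
    using hausdorff[of "f x" "g y"] by metis
  have "open (f -` U)" "open (g -` V)"
    using UV f g by (auto intro: open_vimage)
  then obtain d e where d: "d > 0" "ball x d \<subseteq> f -` U" and e: "e > 0" "ball y e \<subseteq> g -` V"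
    using UV(3,4) by (metis open_contains_ball vimageI2)
  obtain N where N: "1 / real (Suc N) < min d e"
    using eps[of "min d e"] d(1) e(1) by auto
  have "dist x x' < d" if "x' \<in> fst (X N)" for x'
    using X(2)[of N] x[of N] that N unfolding small_def by fastforce
  moreover have "dist y y' < e" if "y' \<in> snd (X N)" for y'
    using X(2)[of N] y[of N] that N unfolding small_def by fastforce
  ultimately have "f ` fst (X N) \<subseteq> U" "g ` snd (X N) \<subseteq> V"
    using d(2) e(2) by (auto simp: subset_eq)
  then have "borel_separated (f ` fst (X N)) (g ` snd (X N))"
    unfolding borel_separated_def using UV by (intro bexI[of _ U]) auto
  then show False
    using X(1) by (auto simp: bad_def)
qed

text \<open>Borel sets are projections of closed sets, so precomposing the maps with
  \<open>fst\<close> reduces this to the closed case.\<close>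

lemma borel_separated_images:
  fixes f :: "'a::polish_space \<Rightarrow> 'c::t2_space" and g :: "'b::polish_space \<Rightarrow> 'c"
  assumes f: "continuous_on UNIV f" and g: "continuous_on UNIV g"
    and "S \<in> sets borel" "T \<in> sets borel" and disj: "f ` S \<inter> g ` T = {}"
  shows "borel_separated (f ` S) (g ` T)"
proof -
  obtain C :: "('a \<times> (nat \<Rightarrow> nat)) set" where C: "closed C" "S = fst ` C"
    using suslin_borel[OF \<open>S \<in> sets borel\<close>] by (auto simp: suslin_def)
  obtain D :: "('b \<times> (nat \<Rightarrow> nat)) set" where D: "closed D" "T = fst ` D"
    using suslin_borel[OF \<open>T \<in> sets borel\<close>] by (auto simp: suslin_def)
  have "borel_separated ((\<lambda>p. f (fst p)) ` C) ((\<lambda>p. g (fst p)) ` D)"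
  proof (rule borel_separated_closed_images)
    show "continuous_on UNIV (\<lambda>p :: 'a \<times> (nat \<Rightarrow> nat). f (fst p))"
      by (rule continuous_on_compose2[OF f]) (auto intro: continuous_intros)
    show "continuous_on UNIV (\<lambda>p :: 'b \<times> (nat \<Rightarrow> nat). g (fst p))"
      by (rule continuous_on_compose2[OF g]) (auto intro: continuous_intros)
  qed (use C D disj in auto)
  then show ?thesis
    by (simp add: C(2) D(2) image_image)
qed

lemma independent_borel_hull:
  fixes f :: "'a::polish_space \<Rightarrow> 'x::polish_space"
  assumes f: "continuous_on UNIV f" and S: "S \<in> sets borel" and R: "R \<in> sets borel"
    and indep: "independent_set R (f ` S)"
  obtains B where "B \<in> sets borel" "f ` S \<subseteq> B" "independent_set R B"
proof -
  let ?h = "\<lambda>p :: 'a \<times> 'x. (f (fst p), snd p)"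
  have h: "continuous_on UNIV ?h"
    by (intro continuous_on_Pair continuous_on_compose2[OF f]) (auto intro: continuous_intros)
  have preimage: "k -` A \<in> sets borel"
    if "continuous_on UNIV k" "A \<in> sets borel" for k :: "'p::topological_space \<Rightarrow> 'q::topological_space" and A
    using measurable_sets[OF borel_measurable_continuous_onI[OF that(1)] that(2)] by simp
  define N where "N = ?h -` R \<inter> fst -` S"
  have "borel_separated (f ` S) (snd ` N)"
  proof (rule borel_separated_images[OF f _ S])
    show "f ` S \<inter> snd ` N = {}"
      using indep by (fastforce simp: independent_set_def N_def)
    show "N \<in> sets borel"
      unfolding N_def using S R by (intro sets.Int preimage h) (auto intro: continuous_intros)
  qed (auto intro: continuous_intros)
  then obtain B0 where B0: "B0 \<in> sets borel" "f ` S \<subseteq> B0" "snd ` N \<inter> B0 = {}"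
    by (auto simp: borel_separated_def)
  \<comment> \<open>No edge of \<open>R\<close> leads from \<open>f\<close>
    S\<open>into\<close>B0\<open>, since its target would lie in\<close>snd \<open>N\<close>. Hence
    \<open>fst\<close> M\<open>is again disjoint from\<close>f \<open>S\<close>.\<close>
  define M where "M = R \<inter> snd -` B0"
  have "borel_separated (f ` S) (fst ` M)"
  proof (rule borel_separated_images[OF f _ S])
    have "(f x, y) \<notin> M" if "x \<in> S" for x y
    proof
      assume "(f x, y) \<in> M"
      then have "(x, y) \<in> N" "y \<in> B0"
        using that by (auto simp: M_def N_def)
      then show False
        using imageI[of "(x, y)" N snd] B0(3) by auto
    qed
    then show "f ` S \<inter> fst ` M = {}"
      by auto
    show "M \<in> sets borel"
      unfolding M_def using R B0(1) by (intro sets.Int preimage) (auto intro: continuous_intros)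
  qed (auto intro: continuous_intros)
  then obtain B1 where B1: "B1 \<in> sets borel" "f ` S \<subseteq> B1" "fst ` M \<inter> B1 = {}"
    by (auto simp: borel_separated_def)
  show thesis
  proof
    show "B0 \<inter> B1 \<in> sets borel" "f ` S \<subseteq> B0 \<inter> B1"
      using B0 B1 by auto
    show "independent_set R (B0 \<inter> B1)"
      unfolding independent_set_def
    proof (intro ballI notI)
      fix x y assume "x \<in> B0 \<inter> B1" "y \<in> B0 \<inter> B1" "(x, y) \<in> R"
      then show False
        using imageI[of "(x, y)" M fst] B1(3) by (auto simp: M_def)
    qed
  qed
qed

subsection \<open>Large sets of configurations\<close>

text \<open>
  A configuration of level n is stored in one function c on binary strings: strings t of length n carry
  the point \<open>fst (c t)\<close>, and a shorter string t of length \<open>n - k - 1\<close> carries the witness \<open>snd (c t)\<close> that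
  the points at \<open>s k @ False # t\<close> and \<open>s k @ True # t\<close> are related by \<open>R k\<close>, a projection of a closed set.
\<close>

definition large :: "'x set set \<Rightarrow> nat \<Rightarrow> (bool list \<Rightarrow> 'x \<times> 'w) set \<Rightarrow> bool" where
  "large \<I> n S \<longleftrightarrow>
     (\<forall>\<B>\<subseteq>\<I>. countable \<B> \<longrightarrow> (\<exists>c\<in>S. \<forall>t. length t = n \<longrightarrow> fst (c t) \<notin> \<Union>\<B>))"

lemma largeE:
  assumes "large \<I> n S" "\<B> \<subseteq> \<I>" "countable \<B>"
  obtains c where "c \<in> S" "\<And>t. length t = n \<Longrightarrow> fst (c t) \<notin> \<Union>\<B>"
  using assms unfolding large_def by meson

lemma large_nonempty: "large \<I> n S \<Longrightarrow> S \<noteq> {}"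
  using largeE[of \<I> n S "{}"] by auto

text \<open>If each \<open>S i\<close> is defeated by a countable family, the union of these
  families is countable and defeats all of them.\<close>

lemma large_UN:
  assumes "large \<I> n (\<Union>i::nat. S i)"
  shows "\<exists>i. large \<I> n (S i)"
proof (rule ccontr)
  assume "\<not> ?thesis"
  then have "\<forall>i. \<exists>\<B>\<subseteq>\<I>. countable \<B> \<and> \<not> (\<exists>c\<in>S i. \<forall>t. length t = n \<longrightarrow> fst (c t) \<notin> \<Union>\<B>)"
    by (auto simp: large_def)
  then obtain \<B> where \<B>: "\<And>i. \<B> i \<subseteq> \<I>" "\<And>i. countable (\<B> i)"
    "\<And>i. \<not> (\<exists>c\<in>S i. \<forall>t. length t = n \<longrightarrow> fst (c t) \<notin> \<Union>(\<B> i))"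
    by metis
  have "(\<Union>i. \<B> i) \<subseteq> \<I>" "countable (\<Union>i. \<B> i)"
    using \<B>(1,2) by auto
  then obtain c where c: "c \<in> (\<Union>i. S i)" "\<And>t. length t = n \<Longrightarrow> fst (c t) \<notin> \<Union>(\<Union>i. \<B> i)"
    using largeE[OF assms] by metis
  then obtain i where "c \<in> S i"
    by blast
  moreover have "\<Union>(\<B> i) \<subseteq> \<Union>(\<Union>i. \<B> i)"
    by blast
  ultimately show False
    using \<B>(3)[of i] c(2) by (meson subsetD)
qed

lemma continuous_on_coordinate: "continuous_on UNIV (\<lambda>c. c i)"
  by (rule continuous_on_product_then_coordinatewise[OF continuous_on_id])

text \<open>One coordinate is treated at a time: a countable cover by small closed sets splits the
  current set, and \<open>large_UN\<close> picks a large piece.\<close>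

lemma large_shrink:
  fixes S :: "(bool list \<Rightarrow> 'x::polish_space \<times> (nat \<Rightarrow> nat)) set"
  assumes "finite T" "closed S" "large \<I> n S" "e > 0"
  shows "\<exists>S'\<subseteq>S. closed S' \<and> large \<I> n S' \<and> (\<forall>t\<in>T. \<forall>c\<in>S'. \<forall>d\<in>S'. dist (c t) (d t) < e)"
  using assms(1)
proof induction
  case empty
  then show ?case
    using assms by blast
next
  case (insert t T)
  then obtain S' where S': "S' \<subseteq> S" "closed S'" "large \<I> n S'"
    "\<forall>t\<in>T. \<forall>c\<in>S'. \<forall>d\<in>S'. dist (c t) (d t) < e"
    by blast
  obtain K :: "nat \<Rightarrow> ('x \<times> (nat \<Rightarrow> nat)) set"
    where K: "\<And>i. closed (K i)" "\<And>i x y. x \<in> K i \<Longrightarrow> y \<in> K i \<Longrightarrow> dist x y < e" "(\<Union>i. K i) = UNIV"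
    using closed_small_cover[OF \<open>e > 0\<close>] by blast
  have "S' = (\<Union>i. S' \<inter> (\<lambda>c. c t) -` K i)"
    using K(3) by blast
  then obtain i where i: "large \<I> n (S' \<inter> (\<lambda>c. c t) -` K i)"
    using S'(3) large_UN[of \<I> n "\<lambda>i. S' \<inter> (\<lambda>c. c t) -` K i"] by auto
  have "closed (S' \<inter> (\<lambda>c. c t) -` K i)"
    using S'(2) closed_vimage[OF K(1) continuous_on_coordinate] by (rule closed_Int)
  with S'(1,4) K(2) i show ?case
    by (intro exI[of _ "S' \<inter> (\<lambda>c. c t) -` K i"]) auto
qed

text \<open>Two configurations from \<open>S\<close> are glued by a new last bit that says which
  copy a string belongs to. This leaves \<open>[]\<close> free to hold the witness of the new edge,
  which joins the two copies of the point at \<open>u\<close>.\<close>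

definition amalgam ::
    "bool list \<Rightarrow> (('x \<times> 'x) \<times> 'w) set \<Rightarrow> (bool list \<Rightarrow> 'x \<times> 'w) set \<Rightarrow> (bool list \<Rightarrow> 'x \<times> 'w) set" where
  "amalgam u E S =
     {c. (\<forall>b. (\<lambda>t. c (t @ [b])) \<in> S) \<and> ((fst (c (u @ [False])), fst (c (u @ [True]))), snd (c [])) \<in> E}"

lemma closed_amalgam:
  fixes S :: "(bool list \<Rightarrow> 'x::topological_space \<times> 'w::topological_space) set"
  assumes "closed S" "closed E"
  shows "closed (amalgam u E S)"
proof -
  let ?r = "\<lambda>b (c :: bool list \<Rightarrow> 'x \<times> 'w) t. c (t @ [b])"
  let ?e = "\<lambda>c :: bool list \<Rightarrow> 'x \<times> 'w. ((fst (c (u @ [False])), fst (c (u @ [True]))), snd (c []))"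
  have "closed (?r b -` S)" for b
    by (intro closed_vimage[OF assms(1)] continuous_on_coordinatewise_then_product continuous_on_coordinate)
  moreover have "closed (?e -` E)"
    by (intro closed_vimage[OF assms(2)] continuous_on_Pair continuous_on_fst continuous_on_snd
        continuous_on_coordinate)
  ultimately have "closed ((\<Inter>b. ?r b -` S) \<inter> ?e -` E)"
    by (intro closed_Int closed_INT) auto
  also have "(\<Inter>b. ?r b -` S) \<inter> ?e -` E = amalgam u E S"
    by (auto simp: amalgam_def)
  finally show ?thesis .
qed

text \<open>Suppose \<open>\<B>\<close> defeats the amalgam and let \<open>T\<close> be the
  configurations in \<open>S\<close> avoiding \<open>\<B>\<close>. The points at \<open>u\<close> of
  members of \<open>T\<close> form an independent set, for an edge among them would yield an amalgam
  avoiding \<open>\<B>\<close>. Adding a Borel independent hull of these points to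
  \<open>\<B>\<close> defeats \<open>S\<close> itself.\<close>

lemma large_amalgam:
  fixes S :: "(bool list \<Rightarrow> 'x::polish_space \<times> (nat \<Rightarrow> nat)) set"
  assumes S: "closed S" "large \<I> n S" and u: "length u = n"
    and E: "fst ` E \<in> sets borel"
    and \<I>: "\<I> \<subseteq> sets borel" "\<And>B. B \<in> sets borel \<Longrightarrow> independent_set (fst ` E) B \<Longrightarrow> B \<in> \<I>"
  shows "large \<I> (Suc n) (amalgam u E S)"
  unfolding large_def
proof (intro allI impI, rule ccontr)
  fix \<B> assume \<B>: "\<B> \<subseteq> \<I>" "countable \<B>"
    and none: "\<not> (\<exists>c\<in>amalgam u E S. \<forall>t. length t = Suc n \<longrightarrow> fst (c t) \<notin> \<Union>\<B>)"
  define T where "T = S \<inter> (\<Inter>t\<in>{t. length t = n}. (\<lambda>c. fst (c t)) -` (- \<Union>\<B>))"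
  have point: "continuous_on UNIV (\<lambda>c :: bool list \<Rightarrow> 'x \<times> (nat \<Rightarrow> nat). fst (c t))" for t
    by (intro continuous_on_fst continuous_on_coordinate)
  have "\<Union>\<B> \<in> sets borel"
    using \<B> \<I>(1) by (intro sets.countable_Union) auto
  then have "- \<Union>\<B> \<in> sets borel"
    by auto
  then have "(\<lambda>c :: bool list \<Rightarrow> 'x \<times> (nat \<Rightarrow> nat). fst (c t)) -` (- \<Union>\<B>) \<in> sets borel" for t
    using measurable_sets[OF borel_measurable_continuous_onI[OF point]] by simp
  moreover have "{t :: bool list. length t = n} \<noteq> {}"
    using u by blast
  ultimately have "T \<in> sets borel"
    unfolding T_def using S(1) by (intro sets.Int sets.countable_INT'') auto
  moreover have "independent_set (fst ` E) ((\<lambda>c. fst (c u)) ` T)"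
    unfolding independent_set_def
  proof (intro ballI notI)
    fix x y assume "x \<in> (\<lambda>c. fst (c u)) ` T" "y \<in> (\<lambda>c. fst (c u)) ` T" "(x, y) \<in> fst ` E"
    then obtain c d w where T: "c \<in> T" "d \<in> T" and edge: "((fst (c u), fst (d u)), w) \<in> E"
      by auto
    define m where "m t = (if t = [] then (undefined, w) else (if last t then d else c) (butlast t))" for t
    have restrict: "(\<lambda>t. m (t @ [b])) = (if b then d else c)" for b
      by (auto simp: m_def)
    have "m [] = (undefined, w)" "\<And>b. m (u @ [b]) = (if b then d else c) u"
      by (simp_all add: m_def)
    then have "m \<in> amalgam u E S"
      using T edge by (auto simp: amalgam_def restrict T_def)
    moreover have "fst (m t) \<notin> \<Union>\<B>" if "length t = Suc n" for t
    proof -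
      have "fst ((if last t then d else c) (butlast t)) \<notin> \<Union>\<B>"
        using T that by (auto simp: T_def)
      moreover have "t \<noteq> []"
        using that by auto
      ultimately show ?thesis
        by (simp add: m_def)
    qed
    ultimately show False
      using none by blast
  qed
  ultimately obtain B where B: "B \<in> sets borel" "(\<lambda>c. fst (c u)) ` T \<subseteq> B" "independent_set (fst ` E) B"
    using independent_borel_hull[OF point _ E] by metis
  then have "insert B \<B> \<subseteq> \<I>" "countable (insert B \<B>)"
    using \<B> \<I>(2) by auto
  then obtain c where c: "c \<in> S" "\<And>t. length t = n \<Longrightarrow> fst (c t) \<notin> \<Union>(insert B \<B>)"
    using largeE[OF S(2)] by metis
  then have "c \<in> T"
    by (auto simp: T_def)
  then show False
    using B(2) c(2)[OF u] by auto
qed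

subsection \<open>The dichotomy for a sequence of relations\<close>

hide_const (open) Sublist.prefix

lemma prefix_Suc: "prefix (Suc n) (z :: nat \<Rightarrow> 'a) = prefix n z @ [z n]"
  by (simp add: subsequence_def)

lemma prefix_conc_snoc:
  "prefix (length u + Suc n) (u \<frown> [b] \<frown> z) = u @ b # prefix n z"
proof -
  have "prefix (length (u @ [b]) + n) ((u @ [b]) \<frown> z) = (u @ [b]) @ prefix n z"
    by (subst prefix_conc_snd) simp_all
  then show ?thesis
    by simp
qed

text \<open>At level 0 a configuration carries a single point, so if \<open>UNIV\<close> is not
  large there, the cover exists. Otherwise closed large sets \<open>S n\<close> are chosen by
  alternately amalgamating and shrinking. Values along a branch then converge, and closedness of
  \<open>E k\<close> carries each relation to the limit.\<close>

proposition graph_sequence_dichotomy: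
  fixes R :: "nat \<Rightarrow> ('x::polish_space \<times> 'x) set" and s :: "nat \<Rightarrow> bool list"
  assumes R: "\<And>k. R k \<in> sets borel" and s: "\<And>k. length (s k) = k"
  shows "(\<exists>\<B>. countable \<B> \<and> \<B> \<subseteq> sets borel \<and> (\<forall>B\<in>\<B>. \<exists>k. independent_set (R k) B) \<and> \<Union>\<B> = UNIV)
    \<or> (\<exists>F. \<forall>k z. (F (s k \<frown> [False] \<frown> z), F (s k \<frown> [True] \<frown> z)) \<in> R k)"
proof -
  define \<I> where "\<I> = {B \<in> sets borel. \<exists>k. independent_set (R k) B}"
  obtain E :: "nat \<Rightarrow> (('x \<times> 'x) \<times> (nat \<Rightarrow> nat)) set" where E: "\<And>k. closed (E k)" "\<And>k. R k = fst ` E k"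
    using suslin_borel[OF R] unfolding suslin_def by metis
  \<comment> \<open>Strings shorter than \<open>n\<close> are included because the witnesses stored
    there must converge as well.\<close>
  define small where "small n S \<longleftrightarrow> (\<forall>t. length t \<le> n \<longrightarrow> (\<forall>c\<in>S. \<forall>d\<in>S. dist (c t) (d t) < (1/2) ^ n))"
    for n and S :: "(bool list \<Rightarrow> 'x \<times> (nat \<Rightarrow> nat)) set"
  have shrink: "\<exists>S'\<subseteq>S. closed S' \<and> large \<I> n S' \<and> small n S'" if "closed S" "large \<I> n S" for S n
  proof -
    have "finite {t :: bool list. length t \<le> n}"
      using finite_lists_length_le[of "UNIV :: bool set" n] by simp
    then show ?thesis
      using large_shrink[OF _ that, of "{t. length t \<le> n}" "(1/2) ^ n"] by (auto simp: small_def)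
  qed
  show ?thesis
  proof (cases "large \<I> 0 (UNIV :: (bool list \<Rightarrow> 'x \<times> (nat \<Rightarrow> nat)) set)")
    case False
    then obtain \<B> where \<B>: "\<B> \<subseteq> \<I>" "countable \<B>"
      "\<And>c :: bool list \<Rightarrow> 'x \<times> (nat \<Rightarrow> nat). fst (c []) \<in> \<Union>\<B>"
      unfolding large_def by auto
    \<comment> \<open>Largeness at level 0 looks only at the point at \<open>[]\<close>, so the
      witness may be arbitrary.\<close>
    have "x \<in> \<Union>\<B>" for x
      using \<B>(3)[of "\<lambda>_. (x, undefined)"] by simp
    then have "\<Union>\<B> = UNIV"
      by blast
    with \<B>(1,2) show ?thesis
      by (intro disjI1 exI[of _ \<B>]) (auto simp: \<I>_def)
  next
    case True
    have "\<exists>S. \<forall>n. (closed (S n) \<and> large \<I> n (S n) \<and> small n (S n)) \<and> S (Suc n) \<subseteq> amalgam (s n) (E n) (S n)"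
    proof (rule dependent_nat_choice)
      show "\<exists>S. closed S \<and> large \<I> 0 S \<and> small 0 S"
        using shrink[OF closed_UNIV True] by blast
      fix S n assume S: "closed S \<and> large \<I> n S \<and> small n S"
      then have "large \<I> (Suc n) (amalgam (s n) (E n) S)"
        using R[of n] by (intro large_amalgam) (auto simp: s E(2) \<I>_def)
      then show "\<exists>S'. (closed S' \<and> large \<I> (Suc n) S' \<and> small (Suc n) S') \<and> S' \<subseteq> amalgam (s n) (E n) S"
        using shrink[OF closed_amalgam[OF _ E(1)]] S by blast
    qed
    then obtain S where S: "\<And>n. large \<I> n (S n)" "\<And>n. small n (S n)"
      "\<And>n. S (Suc n) \<subseteq> amalgam (s n) (E n) (S n)"
      by blast
    have restrict: "(\<lambda>t. c (t @ [b])) \<in> S n" if "c \<in> S (Suc n)" for c b n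
      using S(3)[of n] that by (auto simp: amalgam_def)
    \<comment> \<open>Removing the last bit of \<open>t\<close> undoes one amalgamation. At
      \<open>t = []\<close> the level is \<open>Suc k\<close>, where the edge of index
      \<open>k\<close> was just created.\<close>
    have edge: "((fst (c (s k @ False # t)), fst (c (s k @ True # t))), snd (c t)) \<in> E k"
      if "c \<in> S (length t + Suc k)" for c k t
      using that
    proof (induction t arbitrary: c rule: rev_induct)
      case Nil
      then show ?case
        using S(3)[of k] by (auto simp: amalgam_def)
    next
      case (snoc b t)
      then show ?case
        using snoc.IH[of "\<lambda>t. c (t @ [b])"] restrict[of c "length t + Suc k" b] by simp
    qed
    have smallD: "dist (c t) (d t) < (1/2) ^ n" if "c \<in> S n" "d \<in> S n" "length t \<le> n" for c d t n
      using S(2)[of n] that by (simp add: small_def)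
    \<comment> \<open>Arbitrary members suffice: either copy inside \<open>c (Suc n)\<close> lies in
      \<open>S n\<close> and is therefore close to \<open>c n\<close>.\<close>
    have "\<exists>c. \<forall>n. c n \<in> S n"
      using large_nonempty[OF S(1)] by (intro choice allI) (simp add: ex_in_conv)
    then obtain c where c: "\<And>n. c n \<in> S n"
      by blast
    \<comment> \<open>The offset \<open>j\<close> is 0 for points, stored at strings of full length,
      and \<open>Suc k\<close> for witnesses of edges of index \<open>k\<close>, stored at strings
      shorter by \<open>Suc k\<close>.\<close>
    have converge: "\<exists>L. (\<lambda>n. c (n + j) (prefix n z)) \<longlonglongrightarrow> L" for j z
    proof -
      have "dist (c (n + j) (prefix n z)) (c (Suc n + j) (prefix (Suc n) z)) \<le> (1/2) ^ n" for n
      proof -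
        have "(\<lambda>t. c (Suc n + j) (t @ [z n])) \<in> S (n + j)"
          using restrict[of "c (Suc n + j)" "n + j"] c[of "Suc n + j"] by simp
        then have "dist (c (n + j) (prefix n z)) (c (Suc n + j) (prefix n z @ [z n])) < (1/2) ^ (n + j)"
          using smallD[OF c[of "n + j"], of "\<lambda>t. c (Suc n + j) (t @ [z n])" "prefix n z"] by simp
        also have "\<dots> \<le> (1/2::real) ^ n"
          by (intro power_decreasing) auto
        finally show ?thesis
          by (simp add: prefix_Suc)
      qed
      then show ?thesis
        by (rule geometric_steps_LIMSEQ) blast
    qed
    define P where "P z = lim (\<lambda>n. c n (prefix n z))" for z
    have P: "(\<lambda>n. c n (prefix n z)) \<longlonglongrightarrow> P z" for z
      unfolding P_def using converge[of 0 z] by (auto intro: limI simp: convergent_def convergent_LIMSEQ_iff[symmetric])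
    have "(fst (P (s k \<frown> [False] \<frown> z)), fst (P (s k \<frown> [True] \<frown> z))) \<in> R k" for k z
    proof -
      obtain W where W: "(\<lambda>n. c (n + Suc k) (prefix n z)) \<longlonglongrightarrow> W"
        using converge by blast
      \<comment> \<open>At level \<open>n + Suc k\<close> the string
        \<open>s k @ b # prefix n z\<close> has full length, so the endpoints and their witness come
        from the same configuration.\<close>
      have point: "(\<lambda>n. c (n + Suc k) (s k @ b # prefix n z)) \<longlonglongrightarrow> P (s k \<frown> [b] \<frown> z)" for b
      proof -
        have "prefix (n + Suc k) (s k \<frown> [b] \<frown> z) = s k @ b # prefix n z" for n
          using prefix_conc_snoc[where u = "s k" and n = n and b = b and z = z] by (simp add: s add.commute)
        then show ?thesis
          using LIMSEQ_ignore_initial_segment[OF P[of "s k \<frown> [b] \<frown> z"], of "Suc k"] by simp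
      qed
      have "((fst (P (s k \<frown> [False] \<frown> z)), fst (P (s k \<frown> [True] \<frown> z))), snd W) \<in> E k"
      proof (rule closed_sequentially[OF E(1)])
        show "((fst (c (n + Suc k) (s k @ False # prefix n z)), fst (c (n + Suc k) (s k @ True # prefix n z))),
            snd (c (n + Suc k) (prefix n z))) \<in> E k" for n
          by (rule edge) (use c[of "n + Suc k"] in simp)
        show "(\<lambda>n. ((fst (c (n + Suc k) (s k @ False # prefix n z)), fst (c (n + Suc k) (s k @ True # prefix n z))),
            snd (c (n + Suc k) (prefix n z)))) \<longlonglongrightarrow>
            ((fst (P (s k \<frown> [False] \<frown> z)), fst (P (s k \<frown> [True] \<frown> z))), snd W)"
          by (intro tendsto_Pair tendsto_fst tendsto_snd point W)
      qed
      then show ?thesis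
        unfolding E(2) by (metis fst_conv imageI)
    qed
    then show ?thesis
      by (intro disjI2 exI[of _ "\<lambda>z. fst (P z)"]) simp
  qed
qed

subsection \<open>Actions\<close>

text \<open>A point is colored by the least index \<open>i\<close> of a set of the cover containing
  it, together with \<open>\<gamma> (k i)\<close>. The group element depends on \<open>i\<close>
  alone, so each color class is translated by one element, and independence of \<open>B i\<close>
  for the pulled-back graph is what is required.\<close>

lemma borel_a_coloring_of_cover:
  fixes a :: "'g \<Rightarrow> 'x::topological_space \<Rightarrow> 'x"
  assumes "countable (carrier \<Gamma>)" and \<gamma>: "\<And>k. \<gamma> k \<in> carrier \<Gamma>"
    and \<B>: "countable \<B>" "\<B> \<subseteq> sets borel" "\<Union>\<B> = UNIV"
    and indep: "\<forall>B\<in>\<B>. \<exists>k. independent_set {(x, y). (a (\<gamma> k) x, a (\<gamma> k) y) \<in> G} B"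
  shows "\<exists>c. borel_a_coloring \<Gamma> G a c"
proof -
  have "\<B> \<noteq> {}"
    using \<B>(3) by auto
  define B where "B = from_nat_into \<B>"
  have B: "B i \<in> \<B>" for i
    unfolding B_def using \<open>\<B> \<noteq> {}\<close> by (rule from_nat_into)
  have "\<exists>k. independent_set {(x, y). (a (\<gamma> k) x, a (\<gamma> k) y) \<in> G} (B i)" for i
    using indep B by simp
  then have "\<exists>k. \<forall>i. independent_set {(x, y). (a (\<gamma> (k i)) x, a (\<gamma> (k i)) y) \<in> G} (B i)"
    by (intro choice allI)
  then obtain k where k: "\<And>i. independent_set {(x, y). (a (\<gamma> (k i)) x, a (\<gamma> (k i)) y) \<in> G} (B i)"
    by auto
  define i where "i x = (LEAST i. x \<in> B i)" for x
  have i: "x \<in> B (i x)" for x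
  proof -
    have "x \<in> \<Union>\<B>"
      by (simp add: \<B>(3))
    then obtain A where A: "A \<in> \<B>" "x \<in> A"
      by (rule UnionE)
    then obtain j where "B j = A"
      unfolding B_def using from_nat_into_surj[OF \<B>(1) A(1)] by blast
    with A(2) have "\<exists>i. x \<in> B i"
      by blast
    then show ?thesis
      unfolding i_def by (rule LeastI_ex)
  qed
  have B_borel: "B i \<in> sets borel" for i
    using B \<B>(2) by blast
  have "Measurable.pred borel (\<lambda>x. x \<in> B i)" for i
    using B_borel by simp
  then have "i \<in> measurable borel (count_space UNIV)"
    unfolding i_def by (rule measurable_Least)
  then have "(\<lambda>x. (i x, \<gamma> (k (i x)))) \<in> measurable borel (count_space (UNIV \<times> carrier \<Gamma>))"
    by (rule measurable_compose) (simp add: \<gamma>)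
  moreover have "a_coloring \<Gamma> G a (\<lambda>x. (i x, \<gamma> (k (i x))))"
    unfolding a_coloring_def
  proof (intro conjI allI)
    fix n
    show "independent_set G {a h x |x h. h \<in> carrier \<Gamma> \<and> (i x, \<gamma> (k (i x))) = (n, h)}"
      unfolding independent_set_def
    proof (intro ballI)
      fix u v
      assume "u \<in> {a h x |x h. h \<in> carrier \<Gamma> \<and> (i x, \<gamma> (k (i x))) = (n, h)}"
        and "v \<in> {a h x |x h. h \<in> carrier \<Gamma> \<and> (i x, \<gamma> (k (i x))) = (n, h)}"
      then obtain x y where "u = a (\<gamma> (k n)) x" "v = a (\<gamma> (k n)) y" "i x = n" "i y = n"
        by auto
      then show "(u, v) \<notin> G"
        using k[of n] i[of x] i[of y] by (auto simp: independent_set_def)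
    qed
  qed (use \<gamma> in auto)
  ultimately show ?thesis
    unfolding borel_a_coloring_def by blast
qed

text \<open>Equivariance forces the value at \<open>(g, z)\<close> to be \<open>g\<close> applied to
  the value at \<open>(1, z)\<close>, so \<open>F\<close> on the sequences determines the map. Edges
  are unordered pairs, whence the symmetry of \<open>G\<close>.\<close>

lemma equivariant_hom_of_section:
  assumes a: "group_action \<Gamma> UNIV a" and "sym G" and \<gamma>: "\<And>k. \<gamma> k \<in> carrier \<Gamma>"
    and F: "\<And>k z. (a (\<gamma> k) (F (s k \<frown> [False] \<frown> z)), a (\<gamma> k) (F (s k \<frown> [True] \<frown> z))) \<in> G"
  shows "equivariant_hom \<Gamma> \<gamma> s G a (\<lambda>p. a (fst p) (F (snd p)))"
  unfolding equivariant_hom_def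
proof (intro conjI ballI allI impI)
  fix h x assume "h \<in> carrier \<Gamma>" "x \<in> carrier \<Gamma> \<times> (UNIV :: (nat \<Rightarrow> bool) set)"
  then show "a (fst (a_Gamma \<Gamma> h x)) (F (snd (a_Gamma \<Gamma> h x))) = a h (a (fst x) (F (snd x)))"
    using group_action.composition_rule[OF a, of "F (snd x)" h "fst x"] by (auto simp: a_Gamma_def)
next
  fix x y assume "(x, y) \<in> G_Gamma \<gamma> s"
  then obtain k z where "{x, y} = {(\<gamma> k, s k \<frown> [False] \<frown> z), (\<gamma> k, s k \<frown> [True] \<frown> z)}"
    by (auto simp: G_Gamma_def)
  then show "(a (fst x) (F (snd x)), a (fst y) (F (snd y))) \<in> G"
    using F[of k z] symD[OF \<open>sym G\<close> F[of k z]] by (auto simp: doubleton_eq_iff)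
qed

theorem theorem5p2:
  fixes \<Gamma> :: "('g, 'm) monoid_scheme"
    and \<gamma> :: "nat \<Rightarrow> 'g" and s :: "nat \<Rightarrow> bool list"
    and G :: "((nat \<Rightarrow> nat) \<times> (nat \<Rightarrow> nat)) set"
    and a :: "'g \<Rightarrow> (nat \<Rightarrow> nat) \<Rightarrow> (nat \<Rightarrow> nat)"
  assumes "group \<Gamma>" and "countable (carrier \<Gamma>)"
    and "generic_seq \<Gamma> \<gamma> s"
    and "borel_graph G"
    and "borel_action \<Gamma> a"
  shows "(\<exists>c. borel_a_coloring \<Gamma> G a c) \<or> (\<exists>f. equivariant_hom \<Gamma> \<gamma> s G a f)"
proof -
  have \<gamma>: "\<gamma> k \<in> carrier \<Gamma>" and s: "length (s k) = k" for k
    using assms(3) by (auto simp: generic_seq_def)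
  have G: "sym G" "G \<in> sets borel"
    using assms(4) by (auto simp: borel_graph_def graph_rel_def)
  have a: "group_action \<Gamma> UNIV a"
    and a_meas: "(\<lambda>(h, x). a h x) \<in> measurable (count_space (carrier \<Gamma>) \<Otimes>\<^sub>M borel) borel"
    using assms(5) by (auto simp: borel_action_def)
  define R where "R k = {(x, y). (a (\<gamma> k) x, a (\<gamma> k) y) \<in> G}" for k
  have "R k \<in> sets borel" for k
  proof -
    have ak: "a (\<gamma> k) \<in> measurable borel borel"
      using measurable_compose[OF measurable_Pair1'[of "\<gamma> k" "count_space (carrier \<Gamma>)" borel] a_meas] \<gamma>
      by simp
    \<comment> \<open>\<open>R k\<close> is the preimage of \<open>G\<close> under this map.
      Rewriting with \<open>borel_prod\<close> turns the Borel structure of the product into a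
      product of Borel structures, where measurability is checked by coordinates.\<close>
    have "(\<lambda>p. (a (\<gamma> k) (fst p), a (\<gamma> k) (snd p))) \<in> measurable borel borel"
      unfolding borel_prod[symmetric]
      by (intro measurable_Pair measurable_compose[OF measurable_fst ak] measurable_compose[OF measurable_snd ak])
    from measurable_sets[OF this, of G] G(2) show ?thesis
      by (simp add: R_def vimage_def case_prod_beta')
  qed
  from graph_sequence_dichotomy[OF this s] show ?thesis
  proof
    assume "\<exists>\<B>. countable \<B> \<and> \<B> \<subseteq> sets borel \<and> (\<forall>B\<in>\<B>. \<exists>k. independent_set (R k) B) \<and> \<Union>\<B> = UNIV"
    then show ?thesis
      using borel_a_coloring_of_cover[where \<gamma> = \<gamma>, OF assms(2) \<gamma>] unfolding R_def by metis
  next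
    assume "\<exists>F. \<forall>k z. (F (s k \<frown> [False] \<frown> z), F (s k \<frown> [True] \<frown> z)) \<in> R k"
    then obtain F where "\<And>k z. (F (s k \<frown> [False] \<frown> z), F (s k \<frown> [True] \<frown> z)) \<in> R k"
      by blast
    then show ?thesis
      using equivariant_hom_of_section[OF a G(1), of \<gamma> F s] \<gamma> by (auto simp: R_def)
  qed
qed

end
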